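(* Let $X\subseteq\mathbb{R}^2$ be a set of $n\in\mathbb{N}$ points such that $\Delta(X)\leq\frac{n}{3\pi}\,\delta(X)$. Then $\mu(X,\Delta_2(X))\leq n$.
   Context: For a finite set $X\subseteq\mathbb{R}^2$ determining distances (at least two points), $\Delta(X)$, $\Delta_2(X)$ and $\delta(X)$ denote respectively the largest, the second largest, and the smallest of the distinct values of the Euclidean distance between distinct points of $X$. For $d>0$, $\mu(X,d)$ denotes the multiplicity of $d$ in $X$, i.e. the number of unordered pairs of distinct points of $X$ at distance $d$. *)

theory Defs
  imports "HOL-Analysis.Analysis"
begin

definition distances :: "'a::metric_space set \<Rightarrow> real set" where
  "distances X = {dist x y | x y. x \<in> X \<and> y \<in> X \<and> x \<noteq> y}"

definition max_distance :: "'a::metric_space set \<Rightarrow> real" where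
  "max_distance X = Max (distances X)"

definition min_distance :: "'a::metric_space set \<Rightarrow> real" where
  "min_distance X = Min (distances X)"

(* Second largest among the distinct values, not counted with multiplicity; it is only
   meaningful for a finite set X determining at least two distinct distances. *)
definition second_max_distance :: "'a::metric_space set \<Rightarrow> real" where
  "second_max_distance X = Max (distances X - {max_distance X})"

(* Pairs are unordered: they are represented as two-element sets {x, y}. *)
definition multiplicity_of_distance :: "'a::metric_space set \<Rightarrow> real \<Rightarrow> nat" where
  "multiplicity_of_distance X d =
     card {{x, y} | x y. x \<in> X \<and> y \<in> X \<and> x \<noteq> y \<and> dist x y = d}"

end

(* Call a point of a finite set exposed if a closed half plane meets the set only in that point.
   A farthest point from any given point is exposed, so every second-distance edge has an endpoint
   in H = exposed X, and its other endpoint lies in H or in K = exposed (X - H).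

   Mark the two leftmost edges at each point of H and the leftmost edge at each point of K.  If an
   edge yz with y in H were unmarked, y would have neighbours v, v' to the left of yz and z a
   neighbour u on the other side.  Then u is farther than the second distance from v and v', hence
   at the maximal distance D from both, so y lies between u and the midpoint of v v' and is not
   exposed.  Thus there are at most 2 |H| + |K| edges.

   By Cauchy-Crofton, a convex polygon of diameter at most D has perimeter at most pi D, so H and K
   each have at most pi D / delta <= n / 3 points. *)
theory Submission
  imports Defs
begin

section \<open>Signed areas and distances in the plane\<close>

text \<open>Determinant of the two vectors; positive when \<open>y\<close> points to the left of
  \<open>x\<close>.\<close>

definition cross2 :: "real^2 \<Rightarrow> real^2 \<Rightarrow> real" where
  "cross2 x y = x$1 * y$2 - x$2 * y$1"

lemma inner2: "(x::real^2) \<bullet> y = x$1 * y$1 + x$2 * y$2"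
  by (simp add: inner_vec_def sum_2)

lemma vec2_eq_iff: "(x::real^2) = y \<longleftrightarrow> x$1 = y$1 \<and> x$2 = y$2"
  by (simp add: vec_eq_iff forall_2)

text \<open>For nonzero \<open>w\<close> this expands \<open>a \<bullet> b\<close> in the orthogonal
  basis formed by \<open>w\<close> and its quarter turn, multiplied out to avoid division.\<close>

lemma norm_inner_eq_inner_cross2:
  "(w \<bullet> w) * (a \<bullet> b) = (w \<bullet> a) * (w \<bullet> b) + cross2 w a * cross2 w b"
  unfolding inner2 cross2_def by algebra

text \<open>With \<open>w = z - y\<close>, \<open>p = v - y\<close> and \<open>q = z - u\<close>,
  all of length \<open>d\<close>, the square of \<open>dist u v\<close> exceeds d^2 by twice
  \<open>(w - p) \<bullet> (w - q)\<close>. Both factors have a nonnegative component along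
  \<open>w\<close> and lie strictly on the same side of it, so the product is positive.\<close>

lemma dist_gt_opposite_sides:
  fixes u v y z :: "real^2"
  assumes "dist y z = d" "dist y v = d" "dist z u = d"
    and v: "cross2 (z - y) (v - y) > 0" and u: "cross2 (y - z) (u - z) > 0"
  shows "dist u v > d"
proof -
  define w p q where "w = z - y" and "p = v - y" and "q = z - u"
  have norms: "norm w = d" "norm p = d" "norm q = d"
    using assms by (simp_all add: w_def p_def q_def dist_norm norm_minus_commute)
  have ww: "w \<bullet> w = d\<^sup>2" "p \<bullet> p = d\<^sup>2" "q \<bullet> q = d\<^sup>2"
    using norms by (simp_all add: dot_square_norm)
  have wp: "cross2 w p > 0" using v by (simp add: w_def p_def)
  have wq: "cross2 w q > 0" using u by (simp add: w_def q_def cross2_def algebra_simps)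
  have "w \<noteq> 0" using wp by (auto simp: cross2_def)
  then have d: "d > 0" using norms by auto
  have "w \<bullet> p \<le> d\<^sup>2" "w \<bullet> q \<le> d\<^sup>2"
    using norm_cauchy_schwarz[of w p] norm_cauchy_schwarz[of w q] norms
    by (simp_all add: power2_eq_square)
  then have "0 \<le> (w \<bullet> (w - p)) * (w \<bullet> (w - q))"
    by (simp add: inner_diff_right ww)
  moreover have "cross2 w (w - p) * cross2 w (w - q) = cross2 w p * cross2 w q"
    by (simp add: cross2_def algebra_simps)
  ultimately have "0 < (w \<bullet> w) * ((w - p) \<bullet> (w - q))"
    unfolding norm_inner_eq_inner_cross2 using wp wq by (simp add: add_nonneg_pos)
  then have pos: "0 < (w - p) \<bullet> (w - q)"
    using ww d by (simp add: zero_less_mult_iff)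
  have "u - v = w - p - q" by (simp add: w_def p_def q_def)
  then have "(dist u v)\<^sup>2 = (w - p - q) \<bullet> (w - p - q)"
    by (simp add: dist_norm dot_square_norm)
  also have "\<dots> = d\<^sup>2 + 2 * ((w - p) \<bullet> (w - q))"
    using ww by (simp add: inner_diff inner_commute algebra_simps)
  finally have "(dist u v)\<^sup>2 > d\<^sup>2" using pos by simp
  then show ?thesis using power_less_imp_less_base by fastforce
qed

section \<open>Exposed points and supporting directions\<close>

text \<open>For finite \<open>X\<close> these are the vertices of the convex hull; \<open>a\<close>
  is an inner normal of a line supporting \<open>X\<close> at \<open>p\<close> alone.\<close>

definition exposed :: "(real^2) set \<Rightarrow> (real^2) set" where
  "exposed X = {p \<in> X. \<exists>a. \<forall>z\<in>X - {p}. a \<bullet> (z - p) > 0}"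

lemma exposed_subset: "exposed X \<subseteq> X"
  by (auto simp: exposed_def)

text \<open>The disc about \<open>c\<close> through \<open>x\<close> contains \<open>X\<close>, and
  its tangent at \<open>x\<close>, with inner normal \<open>c - x\<close>, meets it only in
  \<open>x\<close>. The centre \<open>c\<close> may lie outside \<open>X\<close>.\<close>

lemma farthest_exposed:
  assumes "x \<in> X" "\<And>z. z \<in> X \<Longrightarrow> dist z c \<le> dist x c"
  shows "x \<in> exposed X"
proof -
  have "(c - x) \<bullet> (z - x) > 0" if "z \<in> X - {x}" for z
  proof -
    have "(z - x) \<bullet> (z - x) > 0" using that by simp
    moreover have "(z - c) \<bullet> (z - c) \<le> (x - c) \<bullet> (x - c)"
      using assms(2)[of z] that by (simp add: dist_norm norm_le)
    ultimately show ?thesis by (simp add: inner_diff inner_commute)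
  qed
  then show ?thesis using assms(1) by (auto simp: exposed_def)
qed

text \<open>At distance \<open>D\<close>, the largest possible, \<open>x\<close> would be farthest
  from \<open>c\<close> and hence exposed.\<close>

lemma dist_le_not_exposed:
  assumes "d < D" and gap: "\<And>x y. \<lbrakk>x \<in> X; y \<in> X\<rbrakk> \<Longrightarrow> dist x y \<le> d \<or> dist x y = D"
    and x: "x \<in> X - exposed X" and c: "c \<in> X"
  shows "dist x c \<le> d"
proof (rule ccontr)
  assume "\<not> ?thesis"
  then have "dist x c = D" using gap x c by blast
  then have "x \<in> exposed X"
    using x c gap \<open>d < D\<close> by (intro farthest_exposed[of x X c]) force+
  then show False using x by simp
qed

text \<open>Around an exposed point the relation "to the left of" is a strict weak order, ranked by the
  slope relative to a supporting direction.\<close>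

lemma exposed_order:
  assumes "y \<in> exposed X"
  obtains s :: "real^2 \<Rightarrow> real" where
    "\<And>z w. \<lbrakk>z \<in> X - {y}; w \<in> X - {y}\<rbrakk> \<Longrightarrow> cross2 (z - y) (w - y) > 0 \<longleftrightarrow> s z < s w"
proof -
  obtain a where a: "\<forall>z\<in>X - {y}. a \<bullet> (z - y) > 0"
    using assms by (auto simp: exposed_def)
  let ?s = "\<lambda>z. cross2 a (z - y) / (a \<bullet> (z - y))"
  have "cross2 (z - y) (w - y) > 0 \<longleftrightarrow> ?s z < ?s w"
    if "z \<in> X - {y}" "w \<in> X - {y}" for z w
  proof -
    have z: "a \<bullet> (z - y) > 0" and w: "a \<bullet> (w - y) > 0" using a that by auto
    have "a \<noteq> 0" using z by auto
    then have "a \<bullet> a > 0" by simp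
    have "?s z < ?s w \<longleftrightarrow> cross2 a (z - y) * (a \<bullet> (w - y)) < cross2 a (w - y) * (a \<bullet> (z - y))"
      using z w by (simp add: divide_simps)
    also have "\<dots> \<longleftrightarrow> (a \<bullet> a) * cross2 (z - y) (w - y) > 0"
    proof -
      have "(a \<bullet> a) * cross2 p q = cross2 a q * (a \<bullet> p) - cross2 a p * (a \<bullet> q)" for p q
        unfolding inner2 cross2_def by algebra
      then show ?thesis by simp
    qed
    finally show ?thesis using \<open>a \<bullet> a > 0\<close> by (simp add: zero_less_mult_iff)
  qed
  then show ?thesis by (rule that)
qed

lemma cross2_eq_0_scale:
  assumes "cross2 p q = 0" "p \<noteq> 0"
  obtains t where "q = t *\<^sub>R p"
proof
  have "p \<bullet> p \<noteq> 0" using assms by simp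
  moreover have "(p \<bullet> p) *\<^sub>R q = (p \<bullet> q) *\<^sub>R p"
    using assms(1) unfolding vec2_eq_iff inner2 cross2_def
    by (simp; algebra)
  ultimately show "q = ((p \<bullet> q) / (p \<bullet> p)) *\<^sub>R p"
    by (metis divide_inverse_commute scaleR_one scaleR_scaleR left_inverse)
qed

text \<open>Equal distances put \<open>y\<close> and \<open>u\<close> on the perpendicular bisector
  of \<open>v\<close> and \<open>v'\<close>. The line through \<open>y\<close> along
  \<open>w\<close> separates \<open>u\<close> from \<open>v\<close> and \<open>v'\<close>, so
  \<open>y\<close> lies strictly between \<open>u\<close> and their midpoint, which no supporting
  direction at \<open>y\<close> allows.\<close>

lemma not_exposed_bisector:
  assumes y: "y \<in> exposed X" and X: "u \<in> X" "v \<in> X" "v' \<in> X"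
    and eq: "dist y v = dist y v'" "dist u v = dist u v'" and "v \<noteq> v'"
    and v: "cross2 w (v - y) > 0" and v': "cross2 w (v' - y) > 0" and u: "cross2 w (u - y) < 0"
  shows False
proof -
  obtain a where a: "\<forall>z\<in>X - {y}. a \<bullet> (z - y) > 0"
    using y by (auto simp: exposed_def)
  have "v \<noteq> y" "v' \<noteq> y" "u \<noteq> y" using u v v' by (auto simp: cross2_def)
  then have av: "a \<bullet> (v - y) > 0" "a \<bullet> (v' - y) > 0" "a \<bullet> (u - y) > 0" using a X by auto
  \<comment> \<open>\<open>m\<close> is twice the vector from \<open>y\<close> to the midpoint of
    \<open>v\<close> and \<open>v'\<close>.\<close>
  define m where "m = (v - y) + (v' - y)"
  have am: "a \<bullet> m > 0" unfolding m_def inner_add_right using av by (intro add_pos_pos)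
  have wm: "cross2 w m > 0" using v v' by (simp add: m_def cross2_def algebra_simps)
  have e1: "(v - y) \<bullet> (v - y) = (v' - y) \<bullet> (v' - y)"
    using eq(1) by (simp add: dist_norm norm_minus_commute flip: power2_norm_eq_inner)
  have e2: "(v - u) \<bullet> (v - u) = (v' - u) \<bullet> (v' - u)"
    using eq(2) by (simp add: dist_norm norm_minus_commute flip: power2_norm_eq_inner)
  define r where "r = v - v'"
  have "r \<noteq> 0" using \<open>v \<noteq> v'\<close> by (simp add: r_def)
  have rm: "r \<bullet> m = 0" using e1 unfolding r_def m_def inner_diff inner_add by (simp add: inner_commute)
  have ru: "r \<bullet> (u - y) = 0" using e1 e2 unfolding r_def inner_diff by (simp add: inner_commute)
  \<comment> \<open>In the plane, two vectors orthogonal to the nonzero \<open>r\<close> are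
    parallel.\<close>
  have "(r \<bullet> r) * cross2 m (u - y) = 0"
    using rm ru unfolding inner2 cross2_def by algebra
  then have "cross2 m (u - y) = 0" using \<open>r \<noteq> 0\<close> by simp
  moreover have "m \<noteq> 0" using am by auto
  ultimately obtain t where t: "u - y = t *\<^sub>R m" by (rule cross2_eq_0_scale)
  have "t * cross2 w m < 0" using u t by (simp add: cross2_def algebra_simps)
  then have "t < 0" using wm by (simp add: mult_less_0_iff)
  moreover have "t * (a \<bullet> m) > 0" using av(3) t by simp
  ultimately show False using am by (simp add: zero_less_mult_iff)
qed

section \<open>Marking leftmost edges and counting them\<close>

text \<open>Of three such elements, the lowest would have the other two above it.\<close>

lemma card_few_above:
  fixes s :: "'a \<Rightarrow> real"
  assumes "finite N" "inj_on s N"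
  shows "card {z \<in> N. card {v \<in> N. s z < s v} \<le> 1} \<le> 2" (is "card ?L \<le> 2")
proof (rule ccontr)
  assume "\<not> card ?L \<le> 2"
  then have "3 \<le> card ?L" by simp
  then obtain T where T: "T \<subseteq> ?L" "card T = 3"
    by (rule obtain_subset_with_card_n)
  then have "finite T" "T \<noteq> {}" by (auto intro: card_ge_0_finite)
  then obtain z where z: "z \<in> T" "\<And>v. v \<in> T \<Longrightarrow> s z \<le> s v"
    using arg_min_if_finite(1) arg_min_least by metis
  have "T - {z} \<subseteq> {v \<in> N. s z < s v}"
  proof
    fix v assume v: "v \<in> T - {z}"
    then have "s z \<le> s v" "s z \<noteq> s v" "v \<in> N"
      using z T(1) inj_onD[OF assms(2), of z v] by blast+
    then show "v \<in> {v \<in> N. s z < s v}" by simp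
  qed
  then have "card (T - {z}) \<le> card {v \<in> N. s z < s v}"
    using assms(1) by (intro card_mono) auto
  also have "\<dots> \<le> 1" using z(1) T(1) by auto
  finally show False using T(2) z(1) \<open>finite T\<close> by simp
qed

text \<open>The neighbours of an unexposed point may surround it, in which case no edge is leftmost; two
  leftmost edges occur only for two antipodal neighbours, which forces \<open>card X = 3\<close>.\<close>

lemma card_leftmost_le_1:
  assumes dD: "0 < d" "d < D" and gap: "\<And>x y. \<lbrakk>x \<in> X; y \<in> X\<rbrakk> \<Longrightarrow> dist x y \<le> d \<or> dist x y = D"
    and card: "card X > 3" and x: "x \<in> X - exposed X"
  shows "card {y \<in> X. dist x y = d \<and> (\<forall>u\<in>X. dist x u = d \<longrightarrow> \<not> cross2 (y - x) (u - x) > 0)} \<le> 1"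
    (is "card ?M \<le> 1")
proof -
  have "\<not> (\<exists>y\<in>?M. \<exists>y'\<in>?M. y \<noteq> y')"
  proof
    assume "\<exists>y\<in>?M. \<exists>y'\<in>?M. y \<noteq> y'"
    then obtain y y' where y: "y \<in> X" "dist x y = d" "y' \<in> X" "dist x y' = d" "y \<noteq> y'"
      and c: "\<not> cross2 (y - x) (y' - x) > 0" "\<not> cross2 (y' - x) (y - x) > 0" by auto
    have "y - x \<noteq> 0" using y dD by auto
    moreover have "cross2 (y - x) (y' - x) = 0" using c by (simp add: cross2_def algebra_simps)
    ultimately obtain t where t: "y' - x = t *\<^sub>R (y - x)" using cross2_eq_0_scale by blast
    have n: "norm (y - x) = d" "norm (y' - x) = d" using y by (auto simp: dist_norm norm_minus_commute)
    then have "\<bar>t\<bar> = 1" using t dD by simp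
    moreover have "t \<noteq> 1" using t y by auto
    ultimately have "t = -1" by linarith
    then have opp: "y' - x = - (y - x)" using t by simp
    have "dist y y' = 2 * d"
    proof -
      have "y - y' = 2 *\<^sub>R (y - x)" using opp by (simp add: scaleR_2 algebra_simps)
      then show ?thesis using n by (simp add: dist_norm)
    qed
    then have D: "D = 2 * d" using gap[OF y(1,3)] dD by auto
    have noD: "dist c x \<le> d" if "c \<in> X" for c
      using dist_le_not_exposed[OF dD(2) gap x that] by (simp add: dist_commute)
    have "c \<in> {x, y, y'}" if "c \<in> X" for c
    proof -
      \<comment> \<open>Parallelogram law, since \<open>x\<close> is the midpoint of
        \<open>y\<close> and \<open>y'\<close>.\<close>
      have para: "(dist c y)\<^sup>2 + (dist c y')\<^sup>2 = 2 * (dist c x)\<^sup>2 + 2 * d\<^sup>2"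
      proof -
        have 1: "c - y = (c - x) - (y - x)" by simp
        have 2: "c - y' = (c - x) + (y - x)" using opp by (simp add: algebra_simps)
        have "(norm (p - r))\<^sup>2 + (norm (p + r))\<^sup>2 = 2 * (norm p)\<^sup>2 + 2 * (norm r)\<^sup>2"
          for p r :: "real^2"
          by (simp add: power2_norm_eq_inner inner_diff inner_add inner_commute)
        from this[of "c - x" "y - x"] show ?thesis unfolding dist_norm 1 2 n(1) .
      qed
      have cx: "(dist c x)\<^sup>2 \<le> d\<^sup>2" using noD[OF that] by (simp add: power_mono)
      \<comment> \<open>The right side of \<open>para\<close> is at most 4 d^2. A distance
        \<open>D = 2 * d\<close> to one of \<open>y\<close>, \<open>y'\<close> uses all of it, so
        \<open>c\<close> is the other one; if neither occurs, the left side is at most 2 d^2 and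
        \<open>c\<close> is \<open>x\<close>.\<close>
      consider "dist c y = D" | "dist c y' = D" | "dist c y \<le> d" "dist c y' \<le> d"
        using gap[OF \<open>c \<in> X\<close> y(1)] gap[OF \<open>c \<in> X\<close> y(3)] by blast
      then show ?thesis
      proof cases
        case 1
        then have "(dist c y)\<^sup>2 = 4 * d\<^sup>2" using D by (simp add: power_mult_distrib)
        then have "(dist c y')\<^sup>2 \<le> 0" using para cx by linarith
        then show ?thesis by simp
      next
        case 2
        then have "(dist c y')\<^sup>2 = 4 * d\<^sup>2" using D by (simp add: power_mult_distrib)
        then have "(dist c y)\<^sup>2 \<le> 0" using para cx by linarith
        then show ?thesis by simp
      next
        case 3
        then have "(dist c y)\<^sup>2 \<le> d\<^sup>2" "(dist c y')\<^sup>2 \<le> d\<^sup>2" by (simp_all add: power_mono)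
        then have "(dist c x)\<^sup>2 \<le> 0" using para by linarith
        then show ?thesis by simp
      qed
    qed
    then have "X \<subseteq> {x, y, y'}" by blast
    then have "card X \<le> card {x, y, y'}" by (intro card_mono) auto
    also have "\<dots> \<le> 3" by (simp add: card_insert_if)
    finally show False using card by simp
  qed
  then obtain y where "?M \<subseteq> {y}" by blast
  then have "card ?M \<le> card {y}" by (intro card_mono) auto
  then show ?thesis by simp
qed

text \<open>A union bound over marked edges: at most two at each point of \<open>H\<close>, at most
  one at each point of \<open>K\<close>, and every edge is marked at some endpoint.\<close>

lemma card_second_distance_pairs:
  assumes fin: "finite X" and dD: "0 < d" "d < D"
    and gap: "\<And>x y. \<lbrakk>x \<in> X; y \<in> X\<rbrakk> \<Longrightarrow> dist x y \<le> d \<or> dist x y = D" and card: "card X > 3"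
  shows "card {{x, y} | x y. x \<in> X \<and> y \<in> X \<and> x \<noteq> y \<and> dist x y = d}
           \<le> 2 * card (exposed X) + card (exposed (X - exposed X))"
proof -
  define H K where "H = exposed X" and "K = exposed (X - H)"
  \<comment> \<open>\<open>N y\<close> collects the neighbours of \<open>y\<close>.
    \<open>L y\<close> keeps the ends of its two leftmost edges, by counting the neighbours further
    left, and \<open>M x\<close> the end of the leftmost edge, if there is one.\<close>
  define N where "N = (\<lambda>y. {z \<in> X. dist y z = d})"
  define L where "L = (\<lambda>y. {z \<in> N y. card {v \<in> N y. cross2 (z - y) (v - y) > 0} \<le> 1})"
  define M where "M = (\<lambda>x. {y \<in> N x. \<forall>u\<in>N x. \<not> cross2 (y - x) (u - x) > 0})"
  have finN: "finite (N y)" for y using fin by (simp add: N_def)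
  have finHK: "finite H" "finite K"
    using fin exposed_subset by (auto simp: H_def K_def intro: finite_subset)
  have HX: "H \<subseteq> X" and KX: "K \<subseteq> X - H" using exposed_subset by (auto simp: H_def K_def)
  have cardL: "card (L y) \<le> 2" if "y \<in> H" for y
  proof -
    obtain s :: "real^2 \<Rightarrow> real" where s: "\<And>z w. \<lbrakk>z \<in> X - {y}; w \<in> X - {y}\<rbrakk>
        \<Longrightarrow> cross2 (z - y) (w - y) > 0 \<longleftrightarrow> s z < s w"
      using exposed_order \<open>y \<in> H\<close> unfolding H_def by blast
    obtain a where a: "\<forall>z\<in>X - {y}. a \<bullet> (z - y) > 0"
      using \<open>y \<in> H\<close> by (auto simp: exposed_def H_def)
    have NX: "N y \<subseteq> X - {y}" using dD by (auto simp: N_def)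
    \<comment> \<open>Neighbours of equal rank lie on one line through \<open>y\<close>. Equal
      distances leave \<open>t = 1\<close> or \<open>t = -1\<close>, and the supporting direction
      \<open>a\<close> excludes the latter.\<close>
    have "inj_on s (N y)"
    proof
      fix z w assume zw: "z \<in> N y" "w \<in> N y" "s z = s w"
      then have zwX: "z \<in> X - {y}" "w \<in> X - {y}" using NX by auto
      then have "\<not> cross2 (z - y) (w - y) > 0" "\<not> cross2 (w - y) (z - y) > 0"
        using s[of z w] s[of w z] zw(3) by simp_all
      then have "cross2 (z - y) (w - y) = 0" by (simp add: cross2_def algebra_simps)
      moreover have "z - y \<noteq> 0" using zwX by simp
      ultimately obtain t where t: "w - y = t *\<^sub>R (z - y)" using cross2_eq_0_scale by blast
      have "norm (w - y) = d" "norm (z - y) = d"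
        using zw by (auto simp: N_def dist_norm norm_minus_commute)
      then have "\<bar>t\<bar> = 1" using t dD by simp
      moreover have "a \<bullet> (z - y) > 0" "a \<bullet> (w - y) > 0"
        using a zwX by blast+
      then have "a \<bullet> (z - y) > 0" "t * (a \<bullet> (z - y)) > 0" unfolding t by simp_all
      ultimately have "t = 1" by (simp add: zero_less_mult_iff)
      then show "z = w" using t by simp
    qed
    moreover have "L y = {z \<in> N y. card {v \<in> N y. s z < s v} \<le> 1}"
    proof -
      have "{v \<in> N y. cross2 (z - y) (v - y) > 0} = {v \<in> N y. s z < s v}" if "z \<in> N y" for z
        using s NX that by blast
      then show ?thesis unfolding L_def by auto
    qed
    ultimately show ?thesis using card_few_above[OF finN] by simp
  qed
  have cardM: "card (M x) \<le> 1" if "x \<in> K" for x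
  proof -
    have "M x = {y \<in> X. dist x y = d \<and> (\<forall>u\<in>X. dist x u = d \<longrightarrow> \<not> cross2 (y - x) (u - x) > 0)}"
      by (auto simp: M_def N_def)
    moreover have "x \<in> X - exposed X" using that KX by (auto simp: H_def)
    ultimately show ?thesis using card_leftmost_le_1[OF dD gap card] by simp
  qed
  have noD: "dist x c \<le> d" if "x \<in> X - H" "c \<in> X" for x c
    using dist_le_not_exposed[OF dD(2) gap] that unfolding H_def by blast
  \<comment> \<open>An unexposed \<open>z\<close> has no point of \<open>X\<close> beyond distance
    \<open>d\<close>, so a point \<open>y\<close> at distance exactly \<open>d\<close> is farthest
    from it and exposed.\<close>
  have HH: "y \<in> H \<or> z \<in> H" if "y \<in> X" "z \<in> X" "dist y z = d" for y z
  proof (rule ccontr)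
    assume nh: "\<not> ?thesis"
    have "y \<in> exposed X"
      using that nh noD[of z] by (intro farthest_exposed[of y X z]) (auto simp: dist_commute)
    then show False using nh by (simp add: H_def)
  qed
  \<comment> \<open>No point of \<open>X - H\<close> is farther than \<open>d\<close> from
    \<open>y\<close>, so \<open>x\<close> is farthest from the centre \<open>y\<close> within
    \<open>X - H\<close>, even when \<open>y\<close> is in \<open>H\<close>.\<close>
  have inK: "x \<in> K" if "x \<in> X - H" "y \<in> X" "dist x y = d" for x y
    unfolding K_def using that noD by (intro farthest_exposed[of x _ y]) auto
  have marked: "z \<in> L y \<or> (if z \<in> H then y \<in> L z else y \<in> M z)"
    if yz: "y \<in> H" "z \<in> X" "dist y z = d" for y z
  proof (rule ccontr)
    assume neg: "\<not> ?thesis"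
    have yX: "y \<in> X" using yz HX by auto
    have zN: "z \<in> N y" "y \<in> N z" using yz yX by (auto simp: N_def dist_commute)
    \<comment> \<open>Either marking rule at \<open>z\<close> yields a neighbour to the left of the
      edge as seen from \<open>z\<close>, which is the right as seen from \<open>y\<close>.\<close>
    have "\<exists>u\<in>N z. cross2 (y - z) (u - z) > 0"
    proof (cases "z \<in> H")
      case True
      then have "card {u \<in> N z. cross2 (y - z) (u - z) > 0} > 1" using neg zN by (auto simp: L_def)
      then have "{u \<in> N z. cross2 (y - z) (u - z) > 0} \<noteq> {}" by (metis card.empty not_one_less_zero)
      then show ?thesis by blast
    next
      case False
      then show ?thesis using neg zN by (auto simp: M_def)
    qed
    then obtain u where u: "u \<in> N z" "cross2 (y - z) (u - z) > 0" by blast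
    have "card {v \<in> N y. cross2 (z - y) (v - y) > 0} \<ge> 2" using neg zN by (auto simp: L_def)
    then obtain V where V: "V \<subseteq> {v \<in> N y. cross2 (z - y) (v - y) > 0}" "card V = 2"
      by (rule obtain_subset_with_card_n)
    from V(2) obtain v v' where "V = {v, v'}" "v \<noteq> v'" unfolding card_2_iff by blast
    then have v: "v \<in> N y" "v' \<in> N y" "v \<noteq> v'"
      "cross2 (z - y) (v - y) > 0" "cross2 (z - y) (v' - y) > 0"
      using V(1) by auto
    \<comment> \<open>\<open>u\<close> and \<open>p\<close> lie on opposite sides of the edge, so
      their distance exceeds \<open>d\<close> and jumps to \<open>D\<close>. This makes
      \<open>u\<close> equidistant from \<open>v\<close> and \<open>v'\<close>.\<close>
    have D: "dist u p = D" if p: "p \<in> N y" "cross2 (z - y) (p - y) > 0" for p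
    proof -
      have "dist u p > d"
        using p u yz by (intro dist_gt_opposite_sides[of y z d p u]) (simp_all add: N_def)
      then show ?thesis using gap[of u p] p(1) u(1) by (simp add: N_def)
    qed
    have "cross2 (z - y) (u - y) < 0" using u(2) by (simp add: cross2_def algebra_simps)
    then show False
      using not_exposed_bisector[of y X u v v' "z - y"] yz u v D[OF v(1,4)] D[OF v(2,5)]
      by (simp add: N_def H_def)
  qed
  let ?E = "{{x, y} | x y. x \<in> X \<and> y \<in> X \<and> x \<noteq> y \<and> dist x y = d}"
  let ?A = "\<Union>y\<in>H. (\<lambda>z. {y, z}) ` L y" and ?B = "\<Union>x\<in>K. (\<lambda>z. {x, z}) ` M x"
  have mk: "{y, z} \<in> ?A \<union> ?B" if "y \<in> H" "z \<in> X" "dist y z = d" for y z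
  proof -
    have "z \<in> K" if "z \<notin> H"
      using inK[of z y] that \<open>y \<in> H\<close> HX \<open>z \<in> X\<close> \<open>dist y z = d\<close> by (auto simp: dist_commute)
    then consider "z \<in> L y" | "z \<in> H" "y \<in> L z" | "z \<in> K" "y \<in> M z"
      using marked[OF \<open>y \<in> H\<close> \<open>z \<in> X\<close> \<open>dist y z = d\<close>] by (auto split: if_splits)
    then show ?thesis
    proof cases
      case 1 then show ?thesis using \<open>y \<in> H\<close> by blast
    next
      case 2 then show ?thesis by (auto simp: insert_commute)
    next
      case 3 then show ?thesis by (auto simp: insert_commute)
    qed
  qed
  have sub: "?E \<subseteq> ?A \<union> ?B"
  proof
    fix e assume "e \<in> ?E"
    then obtain x y where e: "e = {x, y}" "x \<in> X" "y \<in> X" "dist x y = d" by blast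
    then show "e \<in> ?A \<union> ?B"
      using HH[of x y] mk[of x y] mk[of y x] by (auto simp: insert_commute dist_commute)
  qed
  have finLM: "finite (L y)" "finite (M y)" for y using finN by (auto simp: L_def M_def)
  have "card ((\<lambda>z. {y, z}) ` L y) \<le> 2" if "y \<in> H" for y
    by (rule le_trans[OF card_image_le[OF finLM(1)] cardL[OF that]])
  then have "(\<Sum>y\<in>H. card ((\<lambda>z. {y, z}) ` L y)) \<le> card H * 2"
    using sum_bounded_above[of H _ "2::nat"] by simp
  then have A: "card ?A \<le> card H * 2" using card_UN_le[OF finHK(1)] le_trans by blast
  have "card ((\<lambda>z. {x, z}) ` M x) \<le> 1" if "x \<in> K" for x
    by (rule le_trans[OF card_image_le[OF finLM(2)] cardM[OF that]])
  then have "(\<Sum>x\<in>K. card ((\<lambda>z. {x, z}) ` M x)) \<le> card K * 1"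
    using sum_bounded_above[of K _ "1::nat"] by simp
  then have B: "card ?B \<le> card K * 1" using card_UN_le[OF finHK(2)] le_trans by blast
  have "card ?E \<le> card (?A \<union> ?B)"
    using finHK finLM by (intro card_mono[OF _ sub]) auto
  also have "\<dots> \<le> card ?A + card ?B" by (rule card_Un_le)
  also have "\<dots> \<le> card H * 2 + card K * 1" using A B by (rule add_mono)
  finally show ?thesis by (simp add: H_def K_def mult.commute)
qed

section \<open>Convex polygons: successors and ascents of edges\<close>

text \<open>A half plane exposing a point of \<open>X\<close> also exposes it in the smaller set.
  Bounds for sets equal to their exposed part thus apply to every \<open>exposed X\<close>.\<close>

lemma exposed_exposed: "exposed (exposed X) = exposed X"
  unfolding exposed_def by blast

text \<open>\<open>q\<close> is the next vertex counterclockwise around the hull, found as the point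
  of least rank in \<open>exposed_order\<close>. Strictness holds because the middle one of three
  collinear points is not exposed.\<close>

lemma exposed_successor:
  assumes fin: "finite A" and A: "exposed A = A" and p: "p \<in> A" and "card A \<ge> 2"
  shows "\<exists>q\<in>A. \<forall>r\<in>A - {p, q}. cross2 (q - p) (r - p) > 0"
proof -
  obtain a where a: "\<forall>z\<in>A - {p}. a \<bullet> (z - p) > 0"
    using p A unfolding exposed_def by blast
  obtain s :: "real^2 \<Rightarrow> real" where s: "\<And>z w. \<lbrakk>z \<in> A - {p}; w \<in> A - {p}\<rbrakk>
      \<Longrightarrow> cross2 (z - p) (w - p) > 0 \<longleftrightarrow> s z < s w"
    using exposed_order p A by blast
  have "A - {p} \<noteq> {}"
  proof
    assume "A - {p} = {}"
    then have "A \<subseteq> {p}" by blast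
    then have "card A \<le> card {p}" by (intro card_mono) auto
    then show False using \<open>card A \<ge> 2\<close> by simp
  qed
  moreover have "finite (A - {p})" using fin by simp
  ultimately obtain q where q: "q \<in> A - {p}" "\<And>r. r \<in> A - {p} \<Longrightarrow> s q \<le> s r"
    using arg_min_if_finite(1) arg_min_least by metis
  have "cross2 (q - p) (r - p) > 0" if r: "r \<in> A - {p, q}" for r
  proof (rule ccontr)
    assume "\<not> ?thesis"
    moreover have "\<not> cross2 (r - p) (q - p) > 0" using s[of r q] q r by force
    ultimately have "cross2 (q - p) (r - p) = 0" by (simp add: cross2_def algebra_simps)
    moreover have "q - p \<noteq> 0" using q by simp
    ultimately obtain t where t: "r - p = t *\<^sub>R (q - p)" using cross2_eq_0_scale by blast
    have "a \<bullet> (q - p) > 0" "a \<bullet> (r - p) > 0" using a q r by blast+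
    then have "t > 0" unfolding t by (simp add: zero_less_mult_iff)
    have tr: "p - r = (-t) *\<^sub>R (q - p)" "q - r = (1 - t) *\<^sub>R (q - p)" "r - q = (t - 1) *\<^sub>R (q - p)"
      using t by (simp_all add: algebra_simps)
    have "t \<noteq> 1" using tr r by auto
    \<comment> \<open>The middle point is \<open>r\<close> if \<open>t < 1\<close> and
      \<open>q\<close> if \<open>t > 1\<close>; there a supporting direction would have to be
      positive on two opposite vectors.\<close>
    then consider "t < 1" | "t > 1" by linarith
    then show False
    proof cases
      case 1
      have "r \<in> exposed A" using r A by blast
      then obtain b where b: "\<forall>z\<in>A - {r}. b \<bullet> (z - r) > 0" unfolding exposed_def by blast
      have "b \<bullet> (p - r) > 0" "b \<bullet> (q - r) > 0" using b p q r by blast+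
      then show False unfolding tr using 1 \<open>t > 0\<close> by (simp add: zero_less_mult_iff mult_less_0_iff)
    next
      case 2
      have "q \<in> exposed A" using q A by blast
      then obtain b where b: "\<forall>z\<in>A - {q}. b \<bullet> (z - q) > 0" unfolding exposed_def by blast
      have "b \<bullet> (p - q) > 0" "b \<bullet> (r - q) > 0" using b p q r by blast+
      moreover have "b \<bullet> (p - q) = - (b \<bullet> (q - p))" by (simp add: inner_diff_right)
      ultimately show False unfolding tr using 2 by (simp add: zero_less_mult_iff)
    qed
  qed
  then show ?thesis using q by blast
qed

text \<open>Where the line through \<open>p\<close> and \<open>q\<close> meets the level line of
  \<open>e\<close> at height \<open>t\<close>; meaningful when
  \<open>e \<bullet> p \<noteq> e \<bullet> q\<close>.\<close>

definition level_point :: "real^2 \<Rightarrow> real \<Rightarrow> real^2 \<Rightarrow> real^2 \<Rightarrow> real^2" where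
  "level_point e t p q = p + ((t - e \<bullet> p) / (e \<bullet> q - e \<bullet> p)) *\<^sub>R (q - p)"

text \<open>Two edges of a convex polygon both ascending through the same level would each have to lie to
  the left of the other.\<close>

lemma cross2_level_points:
  assumes A: "p' \<in> A" "q' \<in> A" and left: "\<forall>r\<in>A - {p, q}. cross2 (q - p) (r - p) > 0"
    and t: "e \<bullet> p < t" "t < e \<bullet> q" "e \<bullet> p' < t" "t < e \<bullet> q'" and "p \<noteq> p'"
  shows "cross2 e (level_point e t p' q' - level_point e t p q) > 0"
proof -
  define \<alpha> \<beta> where "\<alpha> = (t - e \<bullet> p) / (e \<bullet> q - e \<bullet> p)" and "\<beta> = (t - e \<bullet> p') / (e \<bullet> q' - e \<bullet> p')"
  define w where "w = level_point e t p' q' - level_point e t p q"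
  have "0 < \<beta>" "\<beta> < 1" using t by (simp_all add: \<beta>_def)
  have lev: "e \<bullet> level_point e t x y = t" if "e \<bullet> x < t" "t < e \<bullet> y" for x y
    using that by (simp add: level_point_def inner_add_right inner_diff_right)
  have ew: "e \<bullet> w = 0" using lev t by (simp add: w_def inner_diff_right)
  have w: "w = (p' - p) + \<beta> *\<^sub>R (q' - p') - \<alpha> *\<^sub>R (q - p)"
    by (simp add: w_def level_point_def \<alpha>_def \<beta>_def)
  \<comment> \<open>The level point between \<open>p'\<close> and \<open>q'\<close> is a convex
    combination of two points weakly left of the edge from \<open>p\<close> to \<open>q\<close>.
    \<open>p'\<close> is strictly left, while \<open>q' = q\<close> is possible.\<close>
  have cw: "cross2 (q - p) w = (1 - \<beta>) * cross2 (q - p) (p' - p) + \<beta> * cross2 (q - p) (q' - p)"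
    unfolding w cross2_def by (simp add: algebra_simps)
  have ge: "cross2 (q - p) (r - p) \<ge> 0" if "r \<in> A" for r
    using left that by (cases "r = p \<or> r = q") (auto simp: cross2_def less_imp_le)
  have "p' \<noteq> p" "p' \<noteq> q" "q' \<noteq> p" using t \<open>p \<noteq> p'\<close> by auto
  then have "cross2 (q - p) (p' - p) > 0" using left A by blast
  then have "cross2 (q - p) w > 0"
    unfolding cw using \<open>0 < \<beta>\<close> \<open>\<beta> < 1\<close> ge[OF A(2)] by (simp add: add_pos_nonneg)
  \<comment> \<open>As \<open>w\<close> is orthogonal to \<open>e\<close> and the edge from
    \<open>p\<close> to \<open>q\<close> ascends, \<open>w\<close> is to the left of
    \<open>e\<close> whenever it is to the left of the edge.\<close>
  moreover have "(e \<bullet> e) * cross2 (q - p) w = (e \<bullet> (q - p)) * cross2 e w"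
    using ew unfolding inner2 cross2_def by algebra
  moreover have "e \<bullet> e > 0" "e \<bullet> (q - p) > 0" using t by (auto simp: inner_diff_right)
  ultimately show ?thesis unfolding w_def[symmetric] by (metis mult_pos_pos zero_less_mult_pos)
qed

text \<open>Ascending edges pass through disjoint ranges of levels, so the total ascent is at most
  the width of \<open>A\<close> in direction \<open>e\<close>. Lebesgue measure adds up the
  ranges.\<close>

lemma sum_ascents_le:
  fixes e :: "real^2"
  assumes fin: "finite A" and "A \<noteq> {}" and diam: "\<And>x y. \<lbrakk>x \<in> A; y \<in> A\<rbrakk> \<Longrightarrow> dist x y \<le> D"
    and nx: "\<And>p. p \<in> A \<Longrightarrow> nx p \<in> A"
    and left: "\<And>p. p \<in> A \<Longrightarrow> \<forall>r\<in>A - {p, nx p}. cross2 (nx p - p) (r - p) > 0"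
  shows "(\<Sum>p\<in>A. max 0 (e \<bullet> (nx p - p))) \<le> norm e * D"
proof -
  define I where "I p = {e \<bullet> p <..< e \<bullet> nx p}" for p
  have disj: "disjoint_family_on I A"
    unfolding disjoint_family_on_def
  proof (intro ballI impI)
    fix p p' assume p: "p \<in> A" "p' \<in> A" "p \<noteq> p'"
    show "I p \<inter> I p' = {}"
    proof (rule ccontr)
      assume "I p \<inter> I p' \<noteq> {}"
      then obtain t where t: "e \<bullet> p < t" "t < e \<bullet> nx p" "e \<bullet> p' < t" "t < e \<bullet> nx p'"
        unfolding I_def by fastforce
      have "cross2 e (level_point e t p' (nx p') - level_point e t p (nx p)) > 0"
        "cross2 e (level_point e t p (nx p) - level_point e t p' (nx p')) > 0"
        using p t nx left by (auto intro!: cross2_level_points[of _ A])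
      then show False by (simp add: cross2_def algebra_simps)
    qed
  qed
  define m M where "m = Min ((\<bullet>) e ` A)" and "M = Max ((\<bullet>) e ` A)"
  have "m \<in> (\<bullet>) e ` A" "M \<in> (\<bullet>) e ` A"
    using fin \<open>A \<noteq> {}\<close> by (auto simp: m_def M_def intro!: Min_in Max_in)
  then obtain x y where xy: "x \<in> A" "y \<in> A" "m = e \<bullet> x" "M = e \<bullet> y" by auto
  have mM: "m \<le> e \<bullet> z" "e \<bullet> z \<le> M" if "z \<in> A" for z
    using fin that by (auto simp: m_def M_def)
  then have "m \<le> M" using xy(1) order_trans by blast
  \<comment> \<open>For an edge that does not ascend, \<open>I p\<close> is empty, which accounts
    for the \<open>max\<close>.\<close>
  have "max 0 (e \<bullet> (nx p - p)) = measure lborel (I p)" for p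
    by (simp add: I_def inner_diff_right max_def)
  then have "(\<Sum>p\<in>A. max 0 (e \<bullet> (nx p - p))) = (\<Sum>p\<in>A. measure lborel (I p))" by simp
  also have "\<dots> = measure lborel (\<Union>p\<in>A. I p)"
  proof (intro measure_finite_Union[symmetric] ballI)
    show "emeasure lborel (I p) \<noteq> \<infinity>" for p
      by (cases "e \<bullet> p \<le> e \<bullet> nx p") (simp_all add: I_def)
  qed (use fin disj in \<open>auto simp: I_def[abs_def]\<close>)
  also have "\<dots> \<le> measure lborel {m..M}"
  proof (rule measure_mono_fmeasurable)
    show "(\<Union>p\<in>A. I p) \<subseteq> {m..M}"
    proof
      fix t assume "t \<in> (\<Union>p\<in>A. I p)"
      then obtain p where "p \<in> A" "e \<bullet> p < t" "t < e \<bullet> nx p" by (auto simp: I_def)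
      then show "t \<in> {m..M}" using mM(1)[of p] mM(2)[of "nx p"] nx by simp
    qed
  qed (use fin \<open>m \<le> M\<close> in \<open>auto simp: I_def fmeasurable_def\<close>)
  also have "\<dots> = e \<bullet> (y - x)" using \<open>m \<le> M\<close> xy by (simp add: inner_diff_right)
  also have "\<dots> \<le> norm e * norm (y - x)" by (rule norm_cauchy_schwarz)
  also have "\<dots> \<le> norm e * D"
    using diam[OF xy(2,1)] by (simp add: dist_norm mult_left_mono)
  finally show ?thesis .
qed

section \<open>Cauchy-Crofton bound on the perimeter\<close>

text \<open>Crofton's formula for one segment. The integrand without absolute value has an
  antiderivative \<open>F\<close> of amplitude \<open>n\<close>; the interval is split where
  \<open>F\<close> attains \<open>n\<close> or \<open>- n\<close>.\<close>

lemma integral_abs_projection_ge: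
  fixes a b :: real
  shows "2 * sqrt (a\<^sup>2 + b\<^sup>2) \<le> integral {0..pi} (\<lambda>\<theta>. \<bar>a * cos \<theta> + b * sin \<theta>\<bar>)"
proof (cases "a = 0 \<and> b = 0")
  case False
  define n where "n = sqrt (a\<^sup>2 + b\<^sup>2)"
  have n: "n > 0" "n\<^sup>2 = a\<^sup>2 + b\<^sup>2" using False by (auto simp: n_def sum_power2_gt_zero_iff)
  define f where "f = (\<lambda>\<theta>. a * cos \<theta> + b * sin \<theta>)"
  define F where "F = (\<lambda>\<theta>. a * sin \<theta> - b * cos \<theta>)"
  have int: "f integrable_on {x..y}" "(\<lambda>\<theta>. \<bar>f \<theta>\<bar>) integrable_on {x..y}" for x y
    unfolding f_def by (intro integrable_continuous_interval continuous_intros)+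
  have bound: "\<bar>F y - F x\<bar> \<le> integral {x..y} (\<lambda>\<theta>. \<bar>f \<theta>\<bar>)" if "x \<le> y" for x y
  proof -
    have "(f has_integral (F y - F x)) {x..y}"
      using that unfolding f_def F_def
      by (intro fundamental_theorem_of_calculus)
         (auto intro!: derivative_eq_intros simp: has_real_derivative_iff_has_vector_derivative[symmetric])
    then have "\<bar>F y - F x\<bar> = \<bar>integral {x..y} f\<bar>" by (simp add: integral_unique)
    also have "\<dots> \<le> integral {x..y} (\<lambda>\<theta>. \<bar>f \<theta>\<bar>)"
      using integral_norm_bound_integral[OF int(1) int(2), of x y] by simp
    finally show ?thesis .
  qed
  \<comment> \<open>\<open>\<psi>\<close> is the angle at which
    \<open>(sin \<psi>, - cos \<psi>)\<close> is \<open>\<sigma>\<close> times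
    \<open>(a, b) / n\<close>, an extremum of \<open>F\<close>. The sign makes the sine nonnegative,
    so that \<open>arccos\<close> finds the angle.\<close>
  define \<sigma> :: real where "\<sigma> = (if a \<ge> 0 then 1 else -1)"
  define \<psi> where "\<psi> = arccos (- \<sigma> * b / n)"
  have "\<bar>b\<bar> \<le> n" unfolding n_def by (rule real_le_rsqrt) simp
  then have "\<bar>- \<sigma> * b / n\<bar> \<le> 1" using n by (simp add: \<sigma>_def abs_mult)
  then have rng: "-1 \<le> - \<sigma> * b / n" "- \<sigma> * b / n \<le> 1" by linarith+
  have \<psi>: "0 \<le> \<psi>" "\<psi> \<le> pi" using rng by (auto simp: \<psi>_def intro: arccos_lbound arccos_ubound)
  have cos: "cos \<psi> = - \<sigma> * b / n" using rng by (simp add: \<psi>_def cos_arccos)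
  have sin: "sin \<psi> = \<sigma> * a / n"
  proof -
    have "\<sigma>\<^sup>2 = 1" by (simp add: \<sigma>_def)
    moreover have "a\<^sup>2 / n\<^sup>2 + b\<^sup>2 / n\<^sup>2 = 1"
      using n by (simp flip: add_divide_distrib n(2))
    ultimately have "(sin \<psi>)\<^sup>2 = (\<sigma> * a / n)\<^sup>2"
      unfolding sin_squared_eq cos by (simp add: power_mult_distrib power_divide)
    moreover have "sin \<psi> \<ge> 0" using \<psi> by (simp add: sin_ge_zero)
    moreover have "\<sigma> * a / n \<ge> 0" using n by (simp add: \<sigma>_def)
    ultimately show ?thesis by (meson power2_eq_imp_eq)
  qed
  have "F \<psi> = \<sigma> * (a\<^sup>2 + b\<^sup>2) / n"
    unfolding F_def cos sin by (simp add: power2_eq_square algebra_simps add_divide_distrib)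
  also have "\<dots> = \<sigma> * n" using n(1) unfolding n(2)[symmetric] by (simp add: power2_eq_square)
  finally have F: "\<bar>F \<psi>\<bar> = n" using n by (simp add: \<sigma>_def)
  \<comment> \<open>Since \<open>F 0 = - b\<close> and \<open>F pi = b\<close>, the boundary terms
    cancel in the triangle inequality.\<close>
  have "2 * n \<le> \<bar>F \<psi> - F 0\<bar> + \<bar>F pi - F \<psi>\<bar>"
    using F by (simp add: F_def)
  also have "\<dots> \<le> integral {0..\<psi>} (\<lambda>\<theta>. \<bar>f \<theta>\<bar>) + integral {\<psi>..pi} (\<lambda>\<theta>. \<bar>f \<theta>\<bar>)"
    using bound \<psi> by (intro add_mono) auto
  also have "\<dots> = integral {0..pi} (\<lambda>\<theta>. \<bar>f \<theta>\<bar>)"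
    using \<psi> int by (intro Henstock_Kurzweil_Integration.integral_combine)
  finally show ?thesis by (simp add: n_def f_def)
qed simp

text \<open>Successive vertices are at least \<open>\<delta>\<close> apart, so the left side is at
  most the perimeter. Twice the perimeter is at most the integral over a half turn of the summed
  edge projections, and these are at most \<open>2 * D\<close> in every direction.\<close>

lemma card_exposed_le:
  assumes fin: "finite A" and A: "exposed A = A" and \<delta>: "0 < \<delta>" "\<delta> \<le> D"
    and diam: "\<And>x y. \<lbrakk>x \<in> A; y \<in> A\<rbrakk> \<Longrightarrow> dist x y \<le> D"
    and sep: "\<And>x y. \<lbrakk>x \<in> A; y \<in> A; x \<noteq> y\<rbrakk> \<Longrightarrow> \<delta> \<le> dist x y"
  shows "real (card A) * \<delta> \<le> pi * D"
proof (cases "card A \<ge> 2")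
  case False
  then have "real (card A) \<le> 1" by simp
  then have "real (card A) * \<delta> \<le> 1 * \<delta>" using \<delta> by (intro mult_right_mono) auto
  also have "\<dots> \<le> pi * D" using \<delta> pi_ge_two by (intro mult_mono) auto
  finally show ?thesis .
next
  case True
  have "\<forall>p\<in>A. \<exists>q\<in>A. \<forall>r\<in>A - {p, q}. cross2 (q - p) (r - p) > 0"
    using exposed_successor[OF fin A _ True] by blast
  then obtain nx where nx: "\<And>p. p \<in> A \<Longrightarrow> nx p \<in> A"
    and left: "\<And>p. p \<in> A \<Longrightarrow> \<forall>r\<in>A - {p, nx p}. cross2 (nx p - p) (r - p) > 0"
    by metis
  have ne: "nx p \<noteq> p" if "p \<in> A" for p
  proof
    assume "nx p = p"
    then have "A - {p} = {}" using left[OF that] by (auto simp: cross2_def)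
    then have "A \<subseteq> {p}" by blast
    then have "card A \<le> card {p}" by (intro card_mono) auto
    then show False using True by simp
  qed
  have "A \<noteq> {}" using True by auto
  define v where "v p = nx p - p" for p
  define g where "g p = (\<lambda>\<theta>. \<bar>v p $ 1 * cos \<theta> + v p $ 2 * sin \<theta>\<bar>)" for p
  have int: "g p integrable_on {0..pi}" for p
    unfolding g_def by (intro integrable_continuous_interval continuous_intros)
  have width: "(\<Sum>p\<in>A. g p \<theta>) \<le> 2 * D" for \<theta>
  proof -
    define e :: "real^2" where "e = vector [cos \<theta>, sin \<theta>]"
    have "norm e = 1" by (simp add: norm_eq_sqrt_inner inner2 e_def flip: power2_eq_square)
    \<comment> \<open>Descents along \<open>e\<close> are ascents along \<open>- e\<close>, so
      \<open>sum_ascents_le\<close> bounds both parts.\<close>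
    have "g p \<theta> = max 0 (e \<bullet> (nx p - p)) + max 0 ((- e) \<bullet> (nx p - p))" for p
    proof -
      have "g p \<theta> = \<bar>e \<bullet> (nx p - p)\<bar>" by (simp add: g_def v_def e_def inner2 mult.commute)
      then show ?thesis by (simp add: max_def)
    qed
    then have "(\<Sum>p\<in>A. g p \<theta>) =
        (\<Sum>p\<in>A. max 0 (e \<bullet> (nx p - p))) + (\<Sum>p\<in>A. max 0 ((- e) \<bullet> (nx p - p)))"
      by (simp add: sum.distrib)
    also have "\<dots> \<le> norm e * D + norm (- e) * D"
      by (intro add_mono sum_ascents_le[OF fin \<open>A \<noteq> {}\<close> diam nx left])
    finally show ?thesis using \<open>norm e = 1\<close> by simp
  qed
  have "real (card A) * \<delta> = (\<Sum>p\<in>A. \<delta>)" by simp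
  also have "\<dots> \<le> (\<Sum>p\<in>A. norm (v p))"
    using sep nx ne by (intro sum_mono) (simp add: v_def dist_norm)
  finally have "2 * (real (card A) * \<delta>) \<le> (\<Sum>p\<in>A. 2 * norm (v p))"
    by (simp flip: sum_distrib_left)
  also have "\<dots> \<le> (\<Sum>p\<in>A. integral {0..pi} (g p))"
  proof (rule sum_mono)
    fix p
    have "norm (v p) = sqrt ((v p $ 1)\<^sup>2 + (v p $ 2)\<^sup>2)"
      by (simp add: norm_eq_sqrt_inner inner2 power2_eq_square)
    then show "2 * norm (v p) \<le> integral {0..pi} (g p)"
      using integral_abs_projection_ge by (simp add: g_def)
  qed
  also have "\<dots> = integral {0..pi} (\<lambda>\<theta>. \<Sum>p\<in>A. g p \<theta>)"
    using fin int by (simp add: integral_sum)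
  also have "\<dots> \<le> integral {0..pi} (\<lambda>\<theta>. 2 * D)"
    using fin int width by (intro integral_le integrable_sum) auto
  also have "\<dots> = 2 * (pi * D)" by simp
  finally show ?thesis by simp
qed

section \<open>Combining the edge count with the perimeter bounds\<close>

theorem corollary1p4:
  fixes X :: "(real ^ 2) set" and n :: nat
  assumes "finite X" and "card X = n" and "n \<ge> 2"
    and "max_distance X \<le> real n / (3 * pi) * min_distance X"
  shows "multiplicity_of_distance X (second_max_distance X) \<le> n"
proof -
  define D \<delta> d where "D = max_distance X" and "\<delta> = min_distance X" and "d = second_max_distance X"
  have "distances X \<subseteq> (\<lambda>(x, y). dist x y) ` (X \<times> X)" by (force simp: distances_def)
  then have finD: "finite (distances X)" using \<open>finite X\<close> by (meson finite_SigmaI finite_imageI finite_subset)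
  obtain x0 y0 where "x0 \<in> X" "y0 \<in> X" "x0 \<noteq> y0"
    using assms(2,3) by (metis card_le_Suc0_iff_eq assms(1) not_less_eq_eq numeral_2_eq_2)
  then have neD: "distances X \<noteq> {}" by (auto simp: distances_def)
  have \<delta>D: "\<delta> \<in> distances X" "D \<in> distances X"
    using finD neD by (simp_all add: \<delta>_def D_def min_distance_def max_distance_def)
  then have "\<delta> > 0" by (auto simp: distances_def)
  have "\<delta> \<le> D" using finD \<delta>D by (simp add: \<delta>_def min_distance_def)
  have inD: "dist x y \<in> distances X" if "x \<in> X" "y \<in> X" "x \<noteq> y" for x y
    using that by (auto simp: distances_def)
  have sep: "\<delta> \<le> dist x y" if "x \<in> X" "y \<in> X" "x \<noteq> y" for x y
    using inD[OF that] finD by (simp add: \<delta>_def min_distance_def)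
  have diam: "dist x y \<le> D" if "x \<in> X" "y \<in> X" for x y
    using inD[OF that] finD \<open>\<delta> > 0\<close> \<open>\<delta> \<le> D\<close> by (cases "x = y") (auto simp: D_def max_distance_def)
  have ratio: "3 * pi * D \<le> real n * \<delta>"
    using assms(4) by (simp add: D_def \<delta>_def field_simps)
  \<comment> \<open>\<open>\<delta> \<le> D\<close> and \<open>pi > 3\<close> force more than nine
    points, while the edge count asks for more than three.\<close>
  have "9 * \<delta> < 3 * pi * \<delta>" using \<open>\<delta> > 0\<close> pi_gt3 by simp
  also have "\<dots> \<le> 3 * pi * D" using \<open>\<delta> \<le> D\<close> by simp
  finally have "9 * \<delta> < real n * \<delta>" using ratio by linarith
  then have "n > 9" using \<open>\<delta> > 0\<close> by simp
  have perim: "real (card (exposed Y)) * \<delta> \<le> pi * D" if "Y \<subseteq> X" for Y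
  proof -
    have sub: "exposed Y \<subseteq> X" using exposed_subset that by blast
    then have "finite (exposed Y)" using \<open>finite X\<close> finite_subset by blast
    then show ?thesis
      by (rule card_exposed_le[OF _ exposed_exposed \<open>\<delta> > 0\<close> \<open>\<delta> \<le> D\<close>])
         (use sub sep diam in blast)+
  qed
  \<comment> \<open>With a single distance every point would be exposed, and the perimeter bound on
    all \<open>n\<close> points would contradict \<open>ratio\<close>. Hence \<open>d\<close> is the
    maximum of a nonempty set.\<close>
  have "distances X - {D} \<noteq> {}"
  proof
    assume one: "distances X - {D} = {}"
    have "X \<subseteq> exposed X"
    proof
      fix x assume "x \<in> X"
      obtain c where c: "c \<in> X" "c \<noteq> x" using \<open>x0 \<in> X\<close> \<open>y0 \<in> X\<close> \<open>x0 \<noteq> y0\<close> by metis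
      have "dist x c = D" using inD[OF \<open>x \<in> X\<close> c(1)] c(2) one by auto
      then show "x \<in> exposed X" using diam c \<open>x \<in> X\<close> by (intro farthest_exposed[of x X c]) auto
    qed
    then have "exposed X = X" using exposed_subset by blast
    then have "real n * \<delta> \<le> pi * D" using perim[of X] assms(2) by simp
    moreover have "pi * D > 0" using \<open>\<delta> > 0\<close> \<open>\<delta> \<le> D\<close> by simp
    ultimately show False using ratio by linarith
  qed
  then have d: "d \<in> distances X - {D}"
    unfolding d_def second_max_distance_def D_def using finD by (intro Max_in) auto
  then have "0 < d" by (auto simp: distances_def)
  have "d < D" using d finD by (auto simp: D_def max_distance_def order.strict_iff_order)
  have gap: "dist x y \<le> d \<or> dist x y = D" if "x \<in> X" "y \<in> X" for x y
  proof (cases "x = y \<or> dist x y = D")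
    case False
    then have "dist x y \<in> distances X - {max_distance X}" using inD that by (simp add: D_def)
    then show ?thesis using finD by (simp add: d_def second_max_distance_def)
  qed (use \<open>0 < d\<close> in auto)
  let ?h = "card (exposed X)" and ?k = "card (exposed (X - exposed X))"
  \<comment> \<open>Three perimeter bounds, two for the outer layer and one for the next, add up to
    \<open>3 * pi * D\<close>.\<close>
  have "real (2 * ?h + ?k) * \<delta> \<le> real n * \<delta>"
    using perim[of X] perim[of "X - exposed X"] ratio by (simp add: algebra_simps)
  then have "2 * ?h + ?k \<le> n" using \<open>\<delta> > 0\<close> by simp
  moreover have "multiplicity_of_distance X d \<le> 2 * ?h + ?k"
    unfolding multiplicity_of_distance_def
    using card_second_distance_pairs[OF \<open>finite X\<close> \<open>0 < d\<close> \<open>d < D\<close> gap] \<open>n > 9\<close> assms(2) by simp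
  ultimately show ?thesis by (simp add: d_def)
qed

end
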